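(* Let $n\in\mathbb{N}$ and let $x,y,z\in\mathbb{P}^*$ be (possibly empty) words such that the concatenation $x(n-1)ynz$ belongs to $\mathcal{S}_n$. Then \[ x(n-1)ynz\ \sim_{ss}\ xny(n-1)z. \]
   Context: $\mathbb{P}$ is the set of positive integers and $\mathbb{P}^*$ the set of finite words over $\mathbb{P}$ (including the empty word). In $x(n-1)ynz$ the symbols $(n-1)$ and $n$ are single letters and juxtaposition is concatenation. $\mathcal{S}_n$ is the set of permutations of $\{1,\ldots,n\}$, viewed as words of length $n$ in which each letter of $\{1,\ldots,n\}$ occurs exactly once. For $w=w_1\cdots w_m\in\mathbb{P}^*$, $|w|=m$ is its length and $\|w\|=w_1+\cdots+w_m$ its height. For words $u,w$, an index $j\ge 1$ is an embedding index of $u$ into $w$ if $j+|u|-1\le|w|$ and $u_i\le w_{j+i-1}$ for all $1\le i\le|u|$; $Em(u,w)$ denotes the set of all embedding indices of $u$ into $w$. A bijection $f:\mathbb{P}^*\to\mathbb{P}^*$ is weight-preserving if $|f(w)|=|w|$ and $\|f(w)\|=\|w\|$ for all $w$. Two words $u,v$ are super-strongly Wilf equivalent, written $u\sim_{ss}v$, if there is a weight-preserving bijection $f:\mathbb{P}^*\to\mathbb{P}^*$ with $Em(u,w)=Em(v,f(w))$ for all $w\in\mathbb{P}^*$. *)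

theory Defs
  imports Main "HOL-Combinatorics.Multiset_Permutations"
begin

text \<open>Words over the positive integers are the lists of natural numbers that do not contain 0.\<close>

definition pos_words :: "nat list set" where
  "pos_words = lists {n. 0 < n}"

definition height :: "nat list \<Rightarrow> nat" where
  "height w = sum_list w"

text \<open>Embedding indices and letter positions are counted from 1, while \<open>!\<close> counts from 0:
  the \<open>k\<close>-th letter of \<open>w\<close> is \<open>w ! (k - 1)\<close>. Since \<open>j \<ge> 1\<close> and \<open>i \<ge> 1\<close>, none of the
  subtractions is truncated.\<close>

definition Em :: "nat list \<Rightarrow> nat list \<Rightarrow> nat set" where
  "Em u w = {j. 1 \<le> j \<and> j + length u - 1 \<le> length w \<and>
                (\<forall>i\<in>{1..length u}. u ! (i - 1) \<le> w ! ((j + i - 1) - 1))}"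

definition weight_preserving :: "(nat list \<Rightarrow> nat list) \<Rightarrow> bool" where
  "weight_preserving f \<longleftrightarrow>
     (\<forall>w\<in>pos_words. length (f w) = length w \<and> height (f w) = height w)"

definition super_strongly_Wilf_equiv :: "nat list \<Rightarrow> nat list \<Rightarrow> bool" (infix "\<sim>\<^sub>s\<^sub>s" 50) where
  "u \<sim>\<^sub>s\<^sub>s v \<longleftrightarrow>
     (\<exists>f. bij_betw f pos_words pos_words \<and> weight_preserving f \<and>
          (\<forall>w\<in>pos_words. Em u w = Em v (f w)))"

end

theory Submission imports Defs begin

text \<open>A positive word \<open>w\<close> into which copies of \<open>u\<close> fit at all indices in \<open>E\<close> has \<open>E\<close> among its
  embedding indices of \<open>u\<close> iff it dominates, letter by letter, one smallest word: the superposition of the copies of \<open>u\<close> placed at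
  the indices in \<open>E\<close>, with 1 wherever no copy reaches. Subtracting this smallest word shows that the
  number of such \<open>w\<close> of given height depends only on the height of the smallest word
  (\<open>card_dominating_words_eq\<close>). Moebius inversion over the supersets of \<open>E\<close> passes from
  ``\<open>E \<subseteq> Em u w\<close>'' to ``\<open>E = Em u w\<close>'', so if the smallest words for \<open>u\<close> and \<open>v\<close> always have
  equal height, then all classes of words with given length, height and embedding set are finite and
  of equal size for \<open>u\<close> and \<open>v\<close>; bijections between these classes combine to one witnessing
  \<open>u \<sim>\<^sub>s\<^sub>s v\<close> (\<open>super_strongly_Wilf_equivI\<close>).

  The height of the smallest word is computed by levels: it is the sum over \<open>t\<close> of the number of
  positions carrying a letter \<open>\<ge> t\<close>, and for \<open>t \<ge> 2\<close> these positions form the sumset of \<open>E\<close>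
  and the set of positions of letters \<open>\<ge> t\<close> in \<open>u\<close> (\<open>superposition_level\<close>). Exchanging the letters
  \<open>n - 1\<close> and \<open>n\<close> changes no level set with \<open>t \<le> n - 1\<close>, and for \<open>t = n\<close> it replaces a singleton
  by another singleton, so that the sumset still has \<open>card E\<close> elements.\<close>

section \<open>Bijections from fibres of equal size\<close>

lemma bij_betw_of_equal_fibres:
  assumes fin: "\<And>c. finite {a\<in>A. p a = c}" "\<And>c. finite {b\<in>B. q b = c}"
    and card_eq: "\<And>c. card {a\<in>A. p a = c} = card {b\<in>B. q b = c}"
  shows "\<exists>f. bij_betw f A B \<and> (\<forall>a\<in>A. q (f a) = p a)"
proof -
  have "\<exists>g. bij_betw g {a\<in>A. p a = c} {b\<in>B. q b = c}" for c
    using finite_same_card_bij[OF fin card_eq] .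
  then obtain g where g: "\<And>c. bij_betw (g c) {a\<in>A. p a = c} {b\<in>B. q b = c}"
    by metis
  define f where "f a = g (p a) a" for a
  have f_in: "f a \<in> B \<and> q (f a) = p a" if "a \<in> A" for a
    using bij_betwE[OF g[of "p a"]] that by (auto simp: f_def)
  have inj: "inj_on f A"
  proof (rule inj_onI)
    fix a a' assume "a \<in> A" "a' \<in> A" "f a = f a'"
    moreover from this have "p a = p a'" using f_in by metis
    ultimately show "a = a'"
      using bij_betw_imp_inj_on[OF g[of "p a"]] by (auto simp: f_def inj_on_def)
  qed
  have "b \<in> f ` A" if "b \<in> B" for b
  proof -
    from that have "b \<in> g (q b) ` {a\<in>A. p a = q b}"
      using bij_betw_imp_surj_on[OF g[of "q b"]] by auto
    then show ?thesis by (force simp: f_def)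
  qed
  with inj f_in have "bij_betw f A B" by (auto simp: bij_betw_def)
  with f_in show ?thesis by blast
qed

text \<open>Moebius inversion on the subsets of \<open>M\<close>, in the form of an induction from the largest
  value set downwards: the objects with value exactly \<open>E\<close> are those with value \<open>\<supseteq> E\<close>, minus those
  with value exactly \<open>F\<close> for some \<open>F \<supset> E\<close>.\<close>

lemma card_fibre_eq_of_card_superset_eq:
  assumes fin: "finite A" "finite B" "finite M"
    and range: "\<And>a. a \<in> A \<Longrightarrow> p a \<subseteq> M" "\<And>b. b \<in> B \<Longrightarrow> q b \<subseteq> M"
    and sup: "\<And>E. E \<subseteq> M \<Longrightarrow> card {a\<in>A. E \<subseteq> p a} = card {b\<in>B. E \<subseteq> q b}"
  shows "card {a\<in>A. p a = E} = card {b\<in>B. q b = E}"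
proof (cases "E \<subseteq> M")
  case False
  then have "{a\<in>A. p a = E} = {}" "{b\<in>B. q b = E} = {}" using range by auto
  then show ?thesis by (simp only: card.empty)
next
  case True
  then show ?thesis
  proof (induction "card (M - E)" arbitrary: E rule: less_induct)
    case less
    let ?S = "{F. E \<subset> F \<and> F \<subseteq> M}"
    have finS: "finite ?S" using fin(3) by simp
    have split: "card {a\<in>C. E \<subseteq> r a} = card {a\<in>C. r a = E} + (\<Sum>F\<in>?S. card {a\<in>C. r a = F})"
      if C: "finite C" and r: "\<And>a. a \<in> C \<Longrightarrow> r a \<subseteq> M" for C and r :: "'d \<Rightarrow> 'c set"
    proof -
      have "{a\<in>C. E \<subseteq> r a} = {a\<in>C. r a = E} \<union> (\<Union>F\<in>?S. {a\<in>C. r a = F})"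
        using r by auto
      also have "card \<dots> = card {a\<in>C. r a = E} + card (\<Union>F\<in>?S. {a\<in>C. r a = F})"
        using C finS by (intro card_Un_disjoint) auto
      also have "card (\<Union>F\<in>?S. {a\<in>C. r a = F}) = (\<Sum>F\<in>?S. card {a\<in>C. r a = F})"
        using C finS by (intro card_UN_disjoint) auto
      finally show ?thesis .
    qed
    have "(\<Sum>F\<in>?S. card {a\<in>A. p a = F}) = (\<Sum>F\<in>?S. card {b\<in>B. q b = F})"
    proof (rule sum.cong[OF refl])
      fix F assume F: "F \<in> ?S"
      then have "M - F \<subset> M - E" by auto
      then have "card (M - F) < card (M - E)" using fin(3) by (intro psubset_card_mono) auto
      with F less.hyps show "card {a\<in>A. p a = F} = card {b\<in>B. q b = F}" by auto
    qed
    moreover have "card {a\<in>A. E \<subseteq> p a} = card {a\<in>A. p a = E} + (\<Sum>F\<in>?S. card {a\<in>A. p a = F})"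
      using fin(1) range(1) by (rule split)
    moreover have "card {b\<in>B. E \<subseteq> q b} = card {b\<in>B. q b = E} + (\<Sum>F\<in>?S. card {b\<in>B. q b = F})"
      using fin(2) range(2) by (rule split)
    ultimately show ?case using sup[OF less.prems] by linarith
  qed
qed

section \<open>Words dominating a given word\<close>

lemma sum_list_eq_sum_lessThan: "sum_list w = (\<Sum>k<length w. w ! k)" for w :: "nat list"
  by (simp add: sum_list_sum_nth atLeast0LessThan)

lemma finite_words_of_height: "finite {w :: nat list. length w = m \<and> sum_list w = h}"
proof (rule finite_subset)
  show "{w :: nat list. length w = m \<and> sum_list w = h} \<subseteq> {w. set w \<subseteq> {..h} \<and> length w = m}"
    by (auto dest: member_le_sum_list)
  show "finite {w. set w \<subseteq> {..h} \<and> length w = m}"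
    by (rule finite_lists_length_eq) simp
qed

text \<open>Translation by \<open>b - a\<close> maps the words above \<open>a\<close> to the words above \<open>b\<close>, and it preserves the
  height when \<open>a\<close> and \<open>b\<close> have the same height.\<close>

lemma card_dominating_words_eq:
  fixes a b :: "nat \<Rightarrow> nat"
  assumes "(\<Sum>k<m. a k) = (\<Sum>k<m. b k)"
  shows "card {w. length w = m \<and> sum_list w = h \<and> (\<forall>k<m. a k \<le> w ! k)}
       = card {w. length w = m \<and> sum_list w = h \<and> (\<forall>k<m. b k \<le> w ! k)}"
proof -
  define D where "D c = {w. length w = m \<and> sum_list w = h \<and> (\<forall>k<m. c k \<le> w ! k)}"
    for c :: "nat \<Rightarrow> nat"
  have le: "card (D c) \<le> card (D d)"
    if cd: "(\<Sum>k<m. c k) = (\<Sum>k<m. d k)" for c d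
  proof (rule card_inj_on_le)
    define s where "s w = map (\<lambda>k. w ! k - c k + d k) [0..<m]" for w
    show "finite (D d)"
      by (rule finite_subset[OF _ finite_words_of_height[of m h]]) (auto simp: D_def)
    show "inj_on s (D c)"
    proof (rule inj_onI)
      fix w w' assume w: "w \<in> D c" "w' \<in> D c" and eq: "s w = s w'"
      show "w = w'"
      proof (rule nth_equalityI)
        show "length w = length w'" using w by (simp add: D_def)
        fix k assume "k < length w"
        then have k: "k < m" using w by (simp add: D_def)
        have "s w ! k = s w' ! k" using eq by simp
        then have "w ! k - c k = w' ! k - c k" using k by (simp add: s_def)
        moreover have "c k \<le> w ! k" "c k \<le> w' ! k" using w k by (auto simp: D_def)
        ultimately show "w ! k = w' ! k" by linarith
      qed
    qed
    show "s ` D c \<subseteq> D d"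
    proof
      fix v assume "v \<in> s ` D c"
      then obtain w where w: "w \<in> D c" and v: "v = s w" by blast
      have "sum_list (s w) + (\<Sum>k<m. c k) = (\<Sum>k<m. (w ! k - c k + d k) + c k)"
        by (simp add: sum_list_eq_sum_lessThan s_def sum.distrib)
      also have "\<dots> = (\<Sum>k<m. w ! k + d k)"
        using w by (intro sum.cong) (auto simp: D_def)
      also have "\<dots> = h + (\<Sum>k<m. c k)"
        using w cd by (auto simp: D_def sum.distrib sum_list_eq_sum_lessThan)
      finally have "sum_list (s w) = h" by simp
      then show "v \<in> D d" by (simp add: D_def v) (simp add: s_def)
    qed
  qed
  from le[OF assms] le[OF assms[symmetric]] show ?thesis by (simp add: D_def)
qed

section \<open>Superpositions of shifted copies\<close>

text \<open>The smallest word with embedding indices \<open>E\<close>, as a function of the position. Positions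
  \<open>k\<close> count from 0 while the indices in \<open>E\<close> count from 1, so the copy of \<open>u\<close> at index \<open>j\<close> has its
  letter \<open>u ! (Suc k - j)\<close> at position \<open>k\<close>.\<close>

definition superposition :: "nat list \<Rightarrow> nat set \<Rightarrow> nat \<Rightarrow> nat" where
  "superposition u E k = Max (insert 1 {u ! (Suc k - j) | j. j \<in> E \<and> j \<le> Suc k \<and> Suc k - j < length u})"

lemma superposition_le_iff:
  assumes "finite E"
  shows "superposition u E k \<le> c \<longleftrightarrow>
    1 \<le> c \<and> (\<forall>j\<in>E. j \<le> Suc k \<longrightarrow> Suc k - j < length u \<longrightarrow> u ! (Suc k - j) \<le> c)"
  using assms by (auto simp: superposition_def)

lemma le_superposition_iff:
  assumes "finite E"
  shows "c \<le> superposition u E k \<longleftrightarrow>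
    c \<le> 1 \<or> (\<exists>j\<in>E. j \<le> Suc k \<and> Suc k - j < length u \<and> c \<le> u ! (Suc k - j))"
  using assms by (auto simp: superposition_def Max_ge_iff)

lemma Em_subset: "Em u w \<subseteq> {1..length w + 1 - length u}"
  by (auto simp: Em_def)

lemma subset_Em_iff_dominates:
  assumes E: "E \<subseteq> {1..length w + 1 - length u}"
  shows "w \<in> pos_words \<and> E \<subseteq> Em u w \<longleftrightarrow> (\<forall>k<length w. superposition u E k \<le> w ! k)"
proof -
  have fin: "finite E" using E finite_subset by blast
  have pos: "w \<in> pos_words \<longleftrightarrow> (\<forall>k<length w. 1 \<le> w ! k)"
    by (auto simp: pos_words_def in_lists_conv_set in_set_conv_nth Suc_le_eq)
  have "j \<in> Em u w \<longleftrightarrow>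
      (\<forall>k<length w. j \<le> Suc k \<longrightarrow> Suc k - j < length u \<longrightarrow> u ! (Suc k - j) \<le> w ! k)"
    (is "_ \<longleftrightarrow> ?R") if "j \<in> E" for j
  proof
    from that E have "j \<in> {1..length w + 1 - length u}" by blast
    then have j: "1 \<le> j" "j + length u \<le> length w + 1" by auto
    { assume *: "j \<in> Em u w"
      show ?R
      proof (intro allI impI)
        fix k assume k: "k < length w" "j \<le> Suc k" "Suc k - j < length u"
        let ?i = "Suc (Suc k - j)"
        have "?i \<in> {1..length u}" using k by auto
        moreover have "\<forall>i\<in>{1..length u}. u ! (i - 1) \<le> w ! ((j + i - 1) - 1)"
          using * by (simp add: Em_def)
        ultimately have "u ! (?i - 1) \<le> w ! ((j + ?i - 1) - 1)" by (rule bspec[rotated])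
        moreover have "(j + ?i - 1) - 1 = k" using k j by simp
        ultimately show "u ! (Suc k - j) \<le> w ! k" by simp
      qed }
    { assume R: ?R
      have "u ! (i - 1) \<le> w ! ((j + i - 1) - 1)" if i: "i \<in> {1..length u}" for i
      proof -
        let ?k = "(j + i - 1) - 1"
        have k: "?k < length w" "j \<le> Suc ?k" "Suc ?k - j < length u" and "Suc ?k - j = i - 1"
          using i j by auto
        with R[rule_format, OF k] show ?thesis by simp
      qed
      with j show "j \<in> Em u w" unfolding Em_def by simp }
  qed
  then have "E \<subseteq> Em u w \<longleftrightarrow>
      (\<forall>k<length w. \<forall>j\<in>E. j \<le> Suc k \<longrightarrow> Suc k - j < length u \<longrightarrow> u ! (Suc k - j) \<le> w ! k)"
    by blast
  with pos show ?thesis unfolding superposition_le_iff[OF fin] by blast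
qed

text \<open>The bijection comes from the fibres of the statistic (length, height, embedding set). They are
  finite since length and height are fixed. They are equally large for \<open>u\<close> and \<open>v\<close> because this holds
  after relaxing equality of the embedding set to inclusion, where the words counted are those
  dominating a superposition.\<close>

lemma super_strongly_Wilf_equivI:
  assumes len: "length u = length v"
    and heights: "\<And>m E. E \<subseteq> {1..m + 1 - length u} \<Longrightarrow>
      (\<Sum>k<m. superposition u E k) = (\<Sum>k<m. superposition v E k)"
  shows "u \<sim>\<^sub>s\<^sub>s v"
proof -
  define W where "W m h = {w\<in>pos_words. length w = m \<and> height w = h}" for m h
  have finW: "finite (W m h)" for m h
    by (rule finite_subset[OF _ finite_words_of_height[of m h]]) (auto simp: W_def height_def)
  have card_Em: "card {w \<in> W m h. Em u w = E} = card {w \<in> W m h. Em v w = E}" for m h E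
  proof (rule card_fibre_eq_of_card_superset_eq[where M = "{1..m + 1 - length u}"])
    show "Em u w \<subseteq> {1..m + 1 - length u}" if "w \<in> W m h" for w
      using that Em_subset[of u w] by (simp add: W_def)
    show "Em v w \<subseteq> {1..m + 1 - length u}" if "w \<in> W m h" for w
      using that Em_subset[of v w] len by (simp add: W_def)
    fix F assume F: "F \<subseteq> {1..m + 1 - length u}"
    have eq: "{w \<in> W m h. F \<subseteq> Em t w}
        = {w. length w = m \<and> sum_list w = h \<and> (\<forall>k<m. superposition t F k \<le> w ! k)}"
      if "length t = length u" for t
    proof -
      have "w \<in> pos_words \<and> F \<subseteq> Em t w \<longleftrightarrow> (\<forall>k<m. superposition t F k \<le> w ! k)"
        if "length w = m" for w
        using subset_Em_iff_dominates[of F w t] F \<open>length t = length u\<close> that by simp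
      then show ?thesis unfolding W_def height_def by blast
    qed
    show "card {w \<in> W m h. F \<subseteq> Em u w} = card {w \<in> W m h. F \<subseteq> Em v w}"
      unfolding eq[OF refl] eq[OF len[symmetric]]
      by (rule card_dominating_words_eq) (rule heights[OF F])
  qed (simp_all add: finW)
  have fibre: "{w\<in>pos_words. (length w, height w, Em t w) = c}
      = {w \<in> W (fst c) (fst (snd c)). Em t w = snd (snd c)}" for t c
    by (cases c) (auto simp: W_def)
  have "\<exists>f. bij_betw f pos_words pos_words \<and>
      (\<forall>w\<in>pos_words. (length (f w), height (f w), Em v (f w)) = (length w, height w, Em u w))"
  proof (rule bij_betw_of_equal_fibres)
    show fin: "finite {w\<in>pos_words. (length w, height w, Em t w) = c}" for t c
      unfolding fibre using finW by simp
    show "finite {w\<in>pos_words. (length w, height w, Em v w) = c}" for c by (rule fin)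
    show "card {w\<in>pos_words. (length w, height w, Em u w) = c}
        = card {w\<in>pos_words. (length w, height w, Em v w) = c}" for c
      unfolding fibre by (rule card_Em)
  qed
  then show ?thesis
    unfolding super_strongly_Wilf_equiv_def weight_preserving_def by auto
qed

section \<open>Heights by levels\<close>

lemma sum_eq_sum_card_levels:
  fixes f :: "'a \<Rightarrow> nat"
  assumes "finite A" and "\<And>k. k \<in> A \<Longrightarrow> f k \<le> N"
  shows "(\<Sum>k\<in>A. f k) = (\<Sum>t\<in>{1..N}. card {k\<in>A. t \<le> f k})"
proof -
  have "(\<Sum>k\<in>A. f k) = (\<Sum>k\<in>A. \<Sum>t\<in>{1..N}. if t \<le> f k then 1 else 0)"
  proof (rule sum.cong[OF refl])
    fix k assume "k \<in> A"
    then have "{t\<in>{1..N}. t \<le> f k} = {1..f k}" using assms(2)[of k] by auto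
    then show "f k = (\<Sum>t\<in>{1..N}. if t \<le> f k then 1 else 0)"
      by (simp flip: sum.inter_filter)
  qed
  also have "\<dots> = (\<Sum>t\<in>{1..N}. card {k\<in>A. t \<le> f k})"
    using assms(1) by (subst sum.swap) (simp flip: sum.inter_filter)
  finally show ?thesis .
qed

text \<open>The range of \<open>E\<close> keeps all copies inside the first \<open>m\<close> positions, so that none of the sumset
  is cut off; level 1 is excluded because the letters 1 between the copies belong to it.\<close>

lemma superposition_level:
  assumes E: "E \<subseteq> {1..m + 1 - length u}" and t: "2 \<le> t"
  shows "{k\<in>{..<m}. t \<le> superposition u E k}
    = (\<lambda>(j, i). j - 1 + i) ` (E \<times> {i. i < length u \<and> t \<le> u ! i})" (is "?L = ?R")
proof (intro equalityI subsetI)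
  have fin: "finite E" using E finite_subset by blast
  { fix k assume "k \<in> ?L"
    then obtain j where j: "j \<in> E" "j \<le> Suc k" "Suc k - j < length u" "t \<le> u ! (Suc k - j)"
      using t by (auto simp: le_superposition_iff[OF fin])
    moreover from j E have "k = j - 1 + (Suc k - j)" by auto
    ultimately show "k \<in> ?R" by (intro image_eqI[of _ _ "(j, Suc k - j)"]) auto }
  { fix k assume "k \<in> ?R"
    then obtain j i where ji: "j \<in> E" "i < length u" "t \<le> u ! i" "k = j - 1 + i" by auto
    from ji E have "j \<in> {1..m + 1 - length u}" by blast
    then have "1 \<le> j" "j + length u \<le> m + 1" by auto
    with ji have "j \<le> Suc k" "Suc k - j = i" "k < m" by auto
    with ji show "k \<in> ?L" by (auto simp: le_superposition_iff[OF fin]) }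
qed

lemma card_superposition_singleton_level:
  assumes E: "E \<subseteq> {1..m + 1 - length u}" and t: "2 \<le> t"
    and single: "{i. i < length u \<and> t \<le> u ! i} = {p}"
  shows "card {k\<in>{..<m}. t \<le> superposition u E k} = card E"
proof -
  have "inj_on (\<lambda>(j, i). j - 1 + i) (E \<times> {p})"
  proof (rule inj_onI, clarsimp)
    fix j j' assume j: "j \<in> E" "j' \<in> E" "j - Suc 0 = j' - Suc 0"
    then have "1 \<le> j" "1 \<le> j'" using E by auto
    with j show "j = j'" by linarith
  qed
  then show ?thesis
    unfolding superposition_level[OF E t] single by (subst card_image) (simp_all add: card_cartesian_product)
qed

section \<open>Exchanging the two largest letters\<close>

theorem proposition3:
  fixes n :: nat and x y z :: "nat list"
  assumes "x \<in> pos_words" and "y \<in> pos_words" and "z \<in> pos_words"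
    and "x @ [n - 1] @ y @ [n] @ z \<in> permutations_of_set {1..n}"
  shows "x @ [n - 1] @ y @ [n] @ z \<sim>\<^sub>s\<^sub>s x @ [n] @ y @ [n - 1] @ z"
proof -
  define u where "u = x @ [n - 1] @ y @ [n] @ z"
  define v where "v = x @ [n] @ y @ [n - 1] @ z"
  define p where "p = length x"
  define q where "q = length x + 1 + length y"
  have u: "set u = {1..n}" "distinct u"
    using assms(4) unfolding u_def permutations_of_set_def by auto
  have set_v: "set v = {1..n}" using u(1) by (auto simp: u_def v_def)
  have "n - 1 \<in> set u" by (simp add: u_def)
  then have n: "2 \<le> n" using u(1) by auto
  have pq: "p < length u" "q < length u" "p \<noteq> q" by (auto simp: u_def p_def q_def)
  have up: "u ! p = n - 1" by (simp add: u_def p_def nth_append)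
  have uq: "u ! q = n" by (simp add: u_def q_def nth_append)
  have len: "length u = length v" by (simp add: u_def v_def)
  have v: "v = u[p := n, q := n - 1]"
    by (simp add: u_def v_def p_def q_def list_update_append)
  have nth_le_u: "u ! i \<le> n" if "i < length u" for i
    using u(1) nth_mem[OF that] by auto
  have nth_v: "v ! i = (if i = p then n else if i = q then n - 1 else u ! i)"
    if "i < length u" for i
    using that pq by (auto simp: v nth_list_update)
  have top_u: "{i. i < length u \<and> n \<le> u ! i} = {q}"
  proof -
    have "i = q" if "i < length u" "n \<le> u ! i" for i
      using nth_eq_iff_index_eq[OF u(2) that(1) pq(2)] nth_le_u[OF that(1)] that(2) uq by simp
    moreover have "n \<le> u ! q" using uq by simp
    ultimately show ?thesis using pq(2) by blast
  qed
  have top_v: "{i. i < length v \<and> n \<le> v ! i} = {p}"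
  proof -
    have "n \<le> v ! i \<longleftrightarrow> i = p" if "i < length u" for i
    proof -
      have "n \<le> u ! i \<longleftrightarrow> i = q" using top_u that by blast
      then show ?thesis using nth_v[OF that] n by auto
    qed
    then show ?thesis using pq(1) len by auto
  qed
  have low: "{i. i < length v \<and> t \<le> v ! i} = {i. i < length u \<and> t \<le> u ! i}" if "t < n" for t
  proof -
    have "t \<le> v ! i \<longleftrightarrow> t \<le> u ! i" if "i < length u" for i
      using nth_v[OF that] \<open>t < n\<close> up uq by auto
    then show ?thesis using len by auto
  qed
  have "(\<Sum>k<m. superposition u E k) = (\<Sum>k<m. superposition v E k)"
    if E: "E \<subseteq> {1..m + 1 - length u}" for m E
  proof -
    have E': "E \<subseteq> {1..m + 1 - length v}" using E len by simp
    have fin: "finite E" using E finite_subset by blast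
    have level: "card {k\<in>{..<m}. t \<le> superposition u E k} = card {k\<in>{..<m}. t \<le> superposition v E k}"
      if t: "t \<in> {1..n}" for t
    proof -
      consider "t = 1" | "2 \<le> t" "t < n" | "t = n" using t by force
      then show ?thesis
      proof cases
        case 1
        then show ?thesis by (simp add: le_superposition_iff[OF fin])
      next
        case 2
        then show ?thesis
          using superposition_level[OF E, of t] superposition_level[OF E', of t] low[of t] by simp
      next
        case 3
        then show ?thesis
          using card_superposition_singleton_level[OF E n top_u]
            card_superposition_singleton_level[OF E' n top_v] by simp
      qed
    qed
    have bounded: "superposition t E k \<le> n" if "set t = {1..n}" for t k
      unfolding superposition_le_iff[OF fin]
    proof (intro conjI ballI impI)
      show "t ! (Suc k - j) \<le> n" if "Suc k - j < length t" for j
        using nth_mem[OF that] \<open>set t = {1..n}\<close> by auto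
    qed (use n in simp)
    have "(\<Sum>k<m. superposition u E k) = (\<Sum>t\<in>{1..n}. card {k\<in>{..<m}. t \<le> superposition u E k})"
      by (rule sum_eq_sum_card_levels) (simp_all only: finite_lessThan bounded[OF u(1)])
    also have "\<dots> = (\<Sum>t\<in>{1..n}. card {k\<in>{..<m}. t \<le> superposition v E k})"
      by (rule sum.cong[OF refl]) (rule level)
    also have "\<dots> = (\<Sum>k<m. superposition v E k)"
      by (rule sum_eq_sum_card_levels[symmetric]) (simp_all only: finite_lessThan bounded[OF set_v])
    finally show ?thesis .
  qed
  from super_strongly_Wilf_equivI[OF len this] show ?thesis by (simp add: u_def v_def)
qed

end
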